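(* Let $n\ge2$, $b>0$, let $\mathbb{T}\subset\mathbb{R}$ be an interval, and for $t\in\mathbb{T}$ let $\mathcal{L}(t)u=u^{(n)}+\sum_{k=0}^{n-2}p_k(x;t)u^{(k)}$, where each $p_k(x;t)$ is complex-valued, $C^\infty$ and $b$-periodic in $x$, depends smoothly on $t$, and $|p_k(x;t)|\le M$ for all $x\in\mathbb{R}$, $t\in\mathbb{T}$, $k=0,\dots,n-2$, for some constant $M$. Let $u_j(x;\lambda;t)$ be the fundamental solutions of $\mathcal{L}(t)u=\lambda u$ ($u_j^{(i-1)}(0;\lambda;t)=\delta_{ij}$) and $$H(\lambda;t)=\det\left[u_j((i-1)b;\lambda;t)\right]_{1\le i,j\le n}.$$ Let $\tilde H(\lambda)$ be the corresponding function for the operator $d^n/dx^n$, namely $$\tilde H(\lambda)=\prod_{0\le j<k\le n-1}\frac{\exp(\rho^k\lambda^{1/n}b)-\exp(\rho^j\lambda^{1/n}b)}{(\rho^k-\rho^j)\lambda^{1/n}},\qquad\rho=e^{2\pi i/n}.$$ Then for every fixed $\delta>0$, $$H(\lambda;t)=\tilde H(\lambda)\left[1+O\left(\lambda^{-1/n}\right)\right]\quad\text{as }\lambda\to\infty,\ \lambda^{1/n}\notin E_\delta,$$ uniformly in $t\in\mathbb{T}$.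
   Context: $\lambda^{1/n}$ denotes the principal $n$-th root. The zeros of $H(\lambda;t)$ are the eigenvalues of the multipoint problem $\mathcal{L}(t)u=\lambda u$, $u(0)=u(b)=\cdots=u((n-1)b)=0$. The set $E_\delta$ is $$E_\delta=\bigcup_{m\in\mathbb{Z}}\ \bigcup_{1\le j<k\le n}\left\{z\in\mathbb{C}:\left|z-\frac{\pi m}{b\sin(\pi(k-j)/n)}e^{-\pi(j+k-2)i/n}\right|<\delta\right\}.$$ *)

theory Defs
  imports "HOL-Analysis.Analysis"
begin

definition smooth_rc :: "(real \<Rightarrow> complex) \<Rightarrow> bool" where
  "smooth_rc f \<longleftrightarrow> (\<exists>D::nat \<Rightarrow> real \<Rightarrow> complex. D 0 = f \<and>
      (\<forall>m x. (D m has_vector_derivative D (Suc m) x) (at x)))"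

definition smooth_rc_on :: "real set \<Rightarrow> (real \<Rightarrow> complex) \<Rightarrow> bool" where
  "smooth_rc_on T f \<longleftrightarrow> (\<exists>D::nat \<Rightarrow> real \<Rightarrow> complex. (\<forall>t\<in>T. D 0 t = f t) \<and>
      (\<forall>m. \<forall>t\<in>T. (D m has_vector_derivative D (Suc m) t) (at t within T)))"

definition fundamental_solution ::
  "nat \<Rightarrow> (nat \<Rightarrow> real \<Rightarrow> complex) \<Rightarrow> complex \<Rightarrow> nat \<Rightarrow> (real \<Rightarrow> complex) \<Rightarrow> bool" where
  "fundamental_solution n q lam j v \<longleftrightarrow> (\<exists>D::nat \<Rightarrow> real \<Rightarrow> complex. D 0 = v \<and>
      (\<forall>i<n. \<forall>x. (D i has_vector_derivative D (Suc i) x) (at x)) \<and>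
      (\<forall>x. D n x + (\<Sum>k<n-1. q k x * D k x) = lam * v x) \<and>
      (\<forall>i<n. D i 0 = (if i = j then 1 else 0)))"

definition detn :: "nat \<Rightarrow> (nat \<Rightarrow> nat \<Rightarrow> complex) \<Rightarrow> complex" where
  "detn n A = (\<Sum>s | s permutes {..<n}. of_int (sign s) * (\<Prod>i<n. A i (s i)))"

definition nroot :: "nat \<Rightarrow> complex \<Rightarrow> complex" where
  "nroot n z = z powr (1 / of_nat n)"

definition Hdet :: "nat \<Rightarrow> real \<Rightarrow> (nat \<Rightarrow> real \<Rightarrow> complex) \<Rightarrow> complex" where
  "Hdet n b u = detn n (\<lambda>i j. u j (of_nat i * b))"

definition Htilde :: "nat \<Rightarrow> real \<Rightarrow> complex \<Rightarrow> complex" where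
  "Htilde n b lam = (let r = nroot n lam; \<rho> = exp (2 * pi * \<i> / of_nat n) in
     (\<Prod>(j,k) \<in> {(j,k). j < k \<and> k \<le> n - 1}.
        (exp (\<rho>^k * r * of_real b) - exp (\<rho>^j * r * of_real b)) / ((\<rho>^k - \<rho>^j) * r)))"

definition E_set :: "nat \<Rightarrow> real \<Rightarrow> real \<Rightarrow> complex set" where
  "E_set n b \<delta> = (\<Union>m::int. \<Union>j\<in>{1..n}. \<Union>k\<in>{j<..n}.
     ball (of_real (pi * of_int m / (b * sin (pi * (real k - real j) / real n)))
           * exp (- of_real (pi * (real j + real k - 2) / real n) * \<i>)) \<delta>)"

end

theory Submission
  imports Defs "Jordan_Normal_Form.Determinant"
begin

text \<open>
  Put \<open>r = \<lambda>\<^sup>1\<^sup>/\<^sup>n\<close> and \<open>w\<^sub>j = \<rho>\<^sup>j r\<close>. In the coordinates dual to the exponentials \<open>exp (w\<^sub>j x)\<close>, the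
  equation becomes a diagonal first order system perturbed by a matrix of size \<open>O(1/r)\<close>. A dichotomy
  estimate gives, for every \<open>k\<close>, a solution on \<open>[0, n b]\<close> whose \<open>j\<close>-th coordinate is
  \<open>exp (w\<^sub>k x) (\<delta>\<^sub>j\<^sub>k + O(1/r))\<close>. Evaluating these \<open>n\<close> solutions at the points \<open>i b\<close>, and their jets at
  \<open>0\<close>, exhibits \<open>H\<close> as a quotient of two perturbed Vandermonde determinants. Each term in the
  expansion of the numerator is bounded by the product over pairs \<open>j < k\<close> of
  \<open>max \<bar>exp (w\<^sub>j b)\<bar> \<bar>exp (w\<^sub>k b)\<bar>\<close>, and outside \<open>E\<^sub>\<delta>\<close> this product is comparable to the
  Vandermonde product itself, so the perturbation is relatively small.
\<close>

subsection \<open>Determinants\<close>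

lemma detn_eq_det: "detn n A = Determinant.det (Matrix.mat n n (\<lambda>(i, j). A i j))"
proof -
  have "(\<Prod>i<n. A i (s i)) = (\<Prod>i<n. Matrix.mat n n (\<lambda>(i, j). A i j) $$ (i, s i))"
    if "s permutes {..<n}" for s
    using permutes_in_image[OF that] by (intro prod.cong) auto
  then show ?thesis
    unfolding detn_def by (subst det_def') (auto simp: atLeast0LessThan intro!: sum.cong)
qed

lemma detn_cong:
  assumes "\<And>i j. i < n \<Longrightarrow> j < n \<Longrightarrow> A i j = B i j"
  shows "detn n A = detn n B"
  unfolding detn_eq_det by (rule arg_cong[of _ _ Determinant.det]) (auto simp: assms)

lemma detn_mult:
  "detn n (\<lambda>i j. \<Sum>k<n. A i k * B k j) = detn n A * detn n B"
proof -
  have "Matrix.mat n n (\<lambda>(i, j). \<Sum>k<n. A i k * B k j)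
      = Matrix.mat n n (\<lambda>(i, j). A i j) * Matrix.mat n n (\<lambda>(i, j). B i j)"
    by (rule eq_matI) (auto simp: scalar_prod_def atLeast0LessThan)
  then show ?thesis
    unfolding detn_eq_det by (simp add: det_mult[of _ n])
qed

lemma detn_lower_triangular:
  assumes "\<And>i j. i < j \<Longrightarrow> j < n \<Longrightarrow> A i j = 0"
  shows "detn n A = (\<Prod>i<n. A i i)"
  unfolding detn_eq_det
  by (subst det_lower_triangular[of n]) (auto simp: assms prod_list_diag_prod atLeast0LessThan)

lemma detn_upper_triangular:
  assumes "\<And>i j. j < i \<Longrightarrow> i < n \<Longrightarrow> A i j = 0"
  shows "detn n A = (\<Prod>i<n. A i i)"
  unfolding detn_eq_det
  by (subst det_upper_triangular[of _ n]) (auto simp: assms prod_list_diag_prod atLeast0LessThan)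

text \<open>Fredholm alternative in finite dimension: triviality of the kernel makes the determinant
  non-zero and the matrix invertible. It turns uniqueness for the boundary value problem into
  existence.\<close>

lemma linear_system_solvable:
  fixes A :: "nat \<Rightarrow> nat \<Rightarrow> complex"
  assumes "\<And>c i. (\<And>i. i < n \<Longrightarrow> (\<Sum>j<n. A i j * c j) = 0) \<Longrightarrow> i < n \<Longrightarrow> c i = 0"
  shows "\<exists>c. \<forall>i<n. (\<Sum>j<n. A i j * c j) = d i"
proof -
  let ?A = "Matrix.mat n n (\<lambda>(i, j). A i j)"
  have A: "?A \<in> carrier_mat n n" by simp
  have "Determinant.det ?A \<noteq> 0"
  proof
    assume "Determinant.det ?A = 0"
    then obtain v where v: "v \<in> carrier_vec n" "v \<noteq> 0\<^sub>v n" "?A *\<^sub>v v = 0\<^sub>v n"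
      using det_0_iff_vec_prod_zero[OF A] by blast
    have "(\<Sum>j<n. A i j * vec_index v j) = 0" if "i < n" for i
    proof -
      have "(\<Sum>j<n. A i j * vec_index v j) = vec_index (?A *\<^sub>v v) i"
        using that v(1) by (auto simp: scalar_prod_def atLeast0LessThan)
      then show ?thesis using that by (simp add: v(3))
    qed
    then have "vec_index v i = 0" if "i < n" for i
      using assms[of "vec_index v"] that by blast
    then have "v = 0\<^sub>v n"
      using v(1) by (intro eq_vecI) auto
    with v(2) show False ..
  qed
  from det_non_zero_imp_unit[OF A this, of "()"]
  obtain B where B: "B \<in> carrier_mat n n" "?A * B = 1\<^sub>m n"
    unfolding Units_def ring_mat_def by auto
  define v where "v = B *\<^sub>v Matrix.vec n d"
  have v: "v \<in> carrier_vec n" using B(1) by (simp add: v_def)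
  have "?A *\<^sub>v v = Matrix.vec n d"
    unfolding v_def using B A
    by (subst assoc_mult_mat_vec[symmetric, of _ n n _ n]) auto
  moreover have "(\<Sum>j<n. A i j * vec_index v j) = vec_index (?A *\<^sub>v v) i" if "i < n" for i
    using that v by (auto simp: scalar_prod_def atLeast0LessThan)
  ultimately show ?thesis
    by (intro exI[of _ "vec_index v"]) auto
qed

section \<open>Products over pairs and the Vandermonde determinant\<close>

lemma prod_pairs_less:
  "(\<Prod>(j, k)\<in>{(j, k). j < k \<and> k < n}. f j k) = (\<Prod>k<n. \<Prod>j<k. f j k)" for n :: nat
proof -
  have "(\<Prod>k<n. \<Prod>j<k. f j k) = (\<Prod>(k, j)\<in>Sigma {..<n} (\<lambda>k. {..<k}). f j k)"
    by (rule prod.Sigma) auto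
  also have "\<dots> = (\<Prod>(j, k)\<in>{(j, k). j < k \<and> k < n}. f j k)"
    by (rule prod.reindex_bij_witness[of _ prod.swap prod.swap]) auto
  finally show ?thesis by simp
qed

text \<open>Multiply on the left by the unitriangular coefficient matrix of the Newton polynomials.\<close>

lemma detn_vandermonde:
  "detn n (\<lambda>i k. x k ^ i) = (\<Prod>(j, k)\<in>{(j, k). j < k \<and> k < n}. x k - x j)"
proof -
  define N where "N i = (\<Prod>m<i. [:- x m, 1:])" for i
  have deg: "degree (N i) = i" for i
    unfolding N_def by (subst degree_prod_eq_sum_degree) auto
  have "coeff (N i) i = 1" for i
    using lead_coeff_prod[of "\<lambda>m. [:- x m, 1:]" "{..<i}"] deg[of i] by (simp add: N_def)
  then have "detn n (\<lambda>i l. coeff (N i) l) = 1"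
    by (subst detn_lower_triangular) (auto intro: coeff_eq_0 simp: deg)
  then have "detn n (\<lambda>i k. x k ^ i)
      = detn n (\<lambda>i k. \<Sum>l<n. coeff (N i) l * x k ^ l)"
    by (simp add: detn_mult)
  also have "\<dots> = detn n (\<lambda>i k. \<Prod>m<i. x k - x m)"
  proof (rule detn_cong)
    fix i k assume "i < n" "k < n"
    have "(\<Prod>m<i. x k - x m) = poly (N i) (x k)"
      by (simp add: N_def poly_prod)
    also have "\<dots> = (\<Sum>l\<le>i. coeff (N i) l * x k ^ l)"
      by (simp add: poly_altdef deg)
    also have "\<dots> = (\<Sum>l<n. coeff (N i) l * x k ^ l)"
      using \<open>i < n\<close> by (intro sum.mono_neutral_left) (auto intro: coeff_eq_0 simp: deg)
    finally show "(\<Sum>l<n. coeff (N i) l * x k ^ l) = (\<Prod>m<i. x k - x m)" by simp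
  qed
  \<comment> \<open>Below the diagonal, \<open>k < i\<close>, the product contains the vanishing
    factor \<open>m = k\<close>.\<close>
  also have "\<dots> = (\<Prod>k<n. \<Prod>m<k. x k - x m)"
    by (rule detn_upper_triangular) (auto intro!: prod_zero)
  finally show ?thesis by (simp add: prod_pairs_less)
qed

section \<open>Perturbation of determinants with weighted entries\<close>

lemma power_one_plus_le:
  fixes t :: real
  assumes "0 \<le> t" "t \<le> 1"
  shows "(1 + t) ^ n \<le> 1 + (2 ^ n - 1) * t"
proof (induction n)
  case (Suc n)
  have "(1 + t) ^ Suc n \<le> (1 + (2 ^ n - 1) * t) * (1 + t)"
    using Suc assms by (simp add: mult_left_mono mult.commute)
  also have "\<dots> = 1 + t * (1 + (2 ^ n - 1) + (2 ^ n - 1) * t)"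
    by (simp add: algebra_simps)
  also have "\<dots> \<le> 1 + t * (1 + (2 ^ n - 1) + (2 ^ n - 1) * 1)"
    using assms by (intro add_left_mono mult_left_mono) auto
  finally show ?case by (simp add: algebra_simps)
qed simp

text \<open>Telescoping replaces one factor at a time. Errors are relative to the majorants
  \<open>s i\<close> rather than to the \<open>z i\<close>, which may vanish.\<close>

lemma norm_prod_diff_le:
  fixes a z :: "nat \<Rightarrow> complex"
  assumes "0 \<le> t" and "\<And>i. i < n \<Longrightarrow> norm (z i) \<le> s i"
    and "\<And>i. i < n \<Longrightarrow> norm (a i - z i) \<le> t * s i"
  shows "norm ((\<Prod>i<n. a i) - (\<Prod>i<n. z i)) \<le> ((1 + t) ^ n - 1) * (\<Prod>i<n. s i)"
  using assms(2,3)
proof (induction n)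
  case (Suc n)
  have s0: "0 \<le> s i" if "i < Suc n" for i
    using Suc.prems(1)[OF that] norm_ge_zero order_trans by blast
  have S0: "0 \<le> (\<Prod>i<n. s i)" using s0 by (intro prod_nonneg) auto
  have an: "norm (a n) \<le> (1 + t) * s n"
    using Suc.prems(1)[of n] Suc.prems(2)[of n] norm_triangle_sub[of "a n" "z n"]
    by (simp add: algebra_simps)
  have Z: "norm (\<Prod>i<n. z i) \<le> (\<Prod>i<n. s i)"
    unfolding prod_norm[symmetric] using Suc.prems(1) by (intro prod_mono) auto
  have "(\<Prod>i<Suc n. a i) - (\<Prod>i<Suc n. z i)
      = ((\<Prod>i<n. a i) - (\<Prod>i<n. z i)) * a n + (\<Prod>i<n. z i) * (a n - z n)"
    by (simp add: algebra_simps)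
  also have "norm \<dots> \<le> ((1 + t) ^ n - 1) * (\<Prod>i<n. s i) * ((1 + t) * s n) + (\<Prod>i<n. s i) * (t * s n)"
    by (intro norm_triangle_le add_mono, unfold norm_mult, insert Suc Z S0 an \<open>0 \<le> t\<close>,
        intro mult_mono) (auto intro!: mult_mono)
  also have "\<dots> = ((1 + t) ^ Suc n - 1) * (\<Prod>i<Suc n. s i)"
    by (simp add: algebra_simps)
  finally show ?case .
qed simp

text \<open>Termwise comparison of the Leibniz expansions, with \<open>fact n\<close> counting the
  permutations. The error is measured against a common bound \<open>S\<close> of the majorant
  products, since cancellation can make the determinant itself much smaller.\<close>

lemma norm_detn_diff_le:
  assumes t: "0 \<le> t" "t \<le> 1"
    and E: "\<And>i j. i < n \<Longrightarrow> j < n \<Longrightarrow> norm (E i j) \<le> s i j"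
    and Y: "\<And>i j. i < n \<Longrightarrow> j < n \<Longrightarrow> norm (Y i j - E i j) \<le> t * s i j"
    and S: "\<And>\<sigma>. \<sigma> permutes {..<n} \<Longrightarrow> (\<Prod>i<n. s i (\<sigma> i)) \<le> S"
  shows "norm (detn n Y - detn n E) \<le> fact n * 2 ^ n * t * S"
proof -
  have "norm ((\<Prod>i<n. Y i (\<sigma> i)) - (\<Prod>i<n. E i (\<sigma> i))) \<le> 2 ^ n * t * S"
    if \<sigma>: "\<sigma> permutes {..<n}" for \<sigma>
  proof -
    have \<sigma>n: "\<sigma> i < n" if "i < n" for i
      using that permutes_in_image[OF \<sigma>, of i] by simp
    have P0: "0 \<le> (\<Prod>i<n. s i (\<sigma> i))"
      using order_trans[OF norm_ge_zero E] \<sigma>n by (intro prod_nonneg) auto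
    have "norm ((\<Prod>i<n. Y i (\<sigma> i)) - (\<Prod>i<n. E i (\<sigma> i)))
        \<le> ((1 + t) ^ n - 1) * (\<Prod>i<n. s i (\<sigma> i))"
      using E Y \<sigma>n t by (intro norm_prod_diff_le) auto
    \<comment> \<open>On \<open>[0, 1]\<close> the convex function \<open>(1 + t) ^ n\<close> lies
      below its chord of slope \<open>2 ^ n - 1\<close>, so the bound becomes linear in
      \<open>t\<close>.\<close>
    also have "\<dots> \<le> (2 ^ n * t) * (\<Prod>i<n. s i (\<sigma> i))"
      using power_one_plus_le[OF t, of n] t P0
      by (intro mult_right_mono) (auto simp: algebra_simps)
    also have "\<dots> \<le> (2 ^ n * t) * S"
      using S[OF \<sigma>] t by (intro mult_left_mono) auto
    finally show ?thesis .
  qed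
  then have "norm (of_int (sign \<sigma>) * (\<Prod>i<n. Y i (\<sigma> i)) - of_int (sign \<sigma>) * (\<Prod>i<n. E i (\<sigma> i)))
      \<le> 2 ^ n * t * S" if "\<sigma> permutes {..<n}" for \<sigma>
    using that unfolding right_diff_distrib[symmetric] norm_mult by (simp add: sign_def)
  then have "norm (detn n Y - detn n E) \<le> of_nat (card {\<sigma>. \<sigma> permutes {..<n}}) * (2 ^ n * t * S)"
    unfolding detn_def sum_subtractf[symmetric] by (intro sum_norm_bound) auto
  then show ?thesis by (simp add: card_permutations[of "{..<n}" n] algebra_simps)
qed

text \<open>A permutation permutes the unordered pairs, and by \<open>sym\<close> the factors depend
  on these only; \<open>ord\<close> selects the increasing representative.\<close>

lemma prod_pairs_permute:
  fixes f :: "nat \<Rightarrow> nat \<Rightarrow> 'a :: comm_monoid_mult"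
  assumes \<sigma>: "\<sigma> permutes {..<n}" and sym: "\<And>j k. f j k = f k j"
  shows "(\<Prod>(j, k)\<in>{(j, k). j < k \<and> k < n}. f (\<sigma> j) (\<sigma> k))
       = (\<Prod>(j, k)\<in>{(j, k). j < k \<and> k < n}. f j k)"
proof -
  define ord where "ord p = (min (fst p) (snd p), max (fst p) (snd p))" for p :: "nat \<times> nat"
  define \<pi> where "\<pi> = inv_into UNIV \<sigma>"
  have \<pi>: "\<pi> permutes {..<n}" using permutes_inv[OF \<sigma>] by (simp add: \<pi>_def)
  have inv: "\<pi> (\<sigma> i) = i" "\<sigma> (\<pi> i) = i" for i
    using permutes_inverses[OF \<sigma>] by (auto simp: \<pi>_def)
  have lt: "\<sigma> i < n" "\<pi> i < n" if "i < n" for i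
    using that permutes_in_image[OF \<sigma>, of i] permutes_in_image[OF \<pi>, of i] by auto
  have ne: "\<sigma> i \<noteq> \<sigma> j" "\<pi> i \<noteq> \<pi> j" if "i \<noteq> j" for i j
    using that inv by metis+
  let ?P = "{(j, k). j < k \<and> k < n}"
  have "inj \<sigma>" "inj \<pi>" using \<sigma> \<pi> by (auto intro: permutes_inj)
  show ?thesis
  proof (rule prod.reindex_bij_witness[of _ "\<lambda>(j, k). ord (\<pi> j, \<pi> k)" "\<lambda>(j, k). ord (\<sigma> j, \<sigma> k)"])
    fix p assume "p \<in> ?P"
    then obtain j k where p: "p = (j, k)" "j < k" "k < n" by auto
    show "(case case p of (j, k) \<Rightarrow> ord (\<sigma> j, \<sigma> k) of (j, k) \<Rightarrow> ord (\<pi> j, \<pi> k)) = p"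
      using p by (auto simp: ord_def min_def max_def inv)
    show "(case case p of (j, k) \<Rightarrow> ord (\<pi> j, \<pi> k) of (j, k) \<Rightarrow> ord (\<sigma> j, \<sigma> k)) = p"
      using p by (auto simp: ord_def min_def max_def inv)
    show "(case p of (j, k) \<Rightarrow> ord (\<sigma> j, \<sigma> k)) \<in> ?P"
      using p lt ne[of j k] by (auto simp: ord_def min_def max_def)
    show "(case p of (j, k) \<Rightarrow> ord (\<pi> j, \<pi> k)) \<in> ?P"
      using p lt ne[of j k] by (auto simp: ord_def min_def max_def)
    show "(case case p of (j, k) \<Rightarrow> ord (\<sigma> j, \<sigma> k) of (j, k) \<Rightarrow> f j k) = (case p of (j, k) \<Rightarrow> f (\<sigma> j) (\<sigma> k))"
      using p by (auto simp: ord_def min_def max_def sym)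
  qed
qed

text \<open>Writing \<open>x\<^sup>i\<close> as a product over the \<open>m < i\<close> distributes the factors over pairs.\<close>

lemma prod_permuted_powers_le:
  fixes x :: "nat \<Rightarrow> real"
  assumes \<sigma>: "\<sigma> permutes {..<n}" and x: "\<And>i. i < n \<Longrightarrow> 0 \<le> x i"
  shows "(\<Prod>i<n. x (\<sigma> i) ^ i) \<le> (\<Prod>(j, k)\<in>{(j, k). j < k \<and> k < n}. max (x j) (x k))"
proof -
  have lt: "\<sigma> i < n" if "i < n" for i
    using that permutes_in_image[OF \<sigma>, of i] by auto
  have "(\<Prod>i<n. x (\<sigma> i) ^ i) = (\<Prod>k<n. \<Prod>j<k. x (\<sigma> k))" by simp
  also have "\<dots> \<le> (\<Prod>k<n. \<Prod>j<k. max (x (\<sigma> j)) (x (\<sigma> k)))"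
    by (intro prod_mono conjI prod_nonneg ballI) (auto simp: x lt)
  also have "\<dots> = (\<Prod>(j, k)\<in>{(j, k). j < k \<and> k < n}. max (x (\<sigma> j)) (x (\<sigma> k)))"
    by (rule prod_pairs_less[symmetric])
  also have "\<dots> = (\<Prod>(j, k)\<in>{(j, k). j < k \<and> k < n}. max (x j) (x k))"
    by (rule prod_pairs_permute[OF \<sigma>]) (rule max.commute)
  finally show ?thesis .
qed

subsection \<open>Exponentials and the dichotomy estimate\<close>

text \<open>If \<open>exp z\<close> is close to 1, then \<open>z\<close> differs from the small
  number \<open>Ln (exp z)\<close> by a multiple of \<open>2 * pi * \<i>\<close>, so
  \<open>z\<close> is close to that lattice.\<close>

lemma norm_exp_minus_one_ge:
  fixes z :: complex
  assumes "\<And>m :: int. \<eta> \<le> norm (z - 2 * pi * m * \<i>)"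
  shows "min (1 / 2) (\<eta> / 2) \<le> norm (exp z - 1)"
proof (rule ccontr)
  assume "\<not> ?thesis"
  then have lt: "norm (exp z - 1) < 1 / 2" "norm (exp z - 1) < \<eta> / 2" by auto
  have "exp (Ln (1 + (exp z - 1))) = exp z"
    by simp
  then obtain m :: int where m: "z = Ln (1 + (exp z - 1)) + (of_int (2 * m) * pi) * \<i>"
    using exp_eq by metis
  have "norm (Ln (1 + (exp z - 1))) \<le> 2 * norm (exp z - 1)"
    by (rule norm_Ln_le[OF lt(1)])
  moreover have "norm (z - 2 * pi * m * \<i>) = norm (Ln (1 + (exp z - 1)))"
    by (subst m) (simp add: algebra_simps)
  ultimately show False using assms[of m] lt(2) by linarith
qed

text \<open>Factoring out \<open>exp b\<close> reduces to the previous lemma. Passing from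
  \<open>norm (exp b)\<close> to the maximum costs one triangle inequality, which turns
  \<open>s\<close> into \<open>s / (1 + s)\<close>.\<close>

lemma norm_exp_diff_ge:
  fixes a b :: complex
  assumes "\<eta> > 0" and "\<And>m :: int. \<eta> \<le> norm (a - b - 2 * pi * m * \<i>)"
    and s: "s = min (1 / 2) (\<eta> / 2)"
  shows "s / (1 + s) * max (norm (exp a)) (norm (exp b)) \<le> norm (exp a - exp b)"
proof -
  have s0: "s > 0" using assms by auto
  have "exp a - exp b = exp b * (exp (a - b) - 1)"
    by (simp add: exp_diff right_diff_distrib)
  then have "norm (exp b) * s \<le> norm (exp a - exp b)"
    using norm_exp_minus_one_ge[of \<eta> "a - b"] assms(2) by (simp add: norm_mult s mult_left_mono)
  moreover have "norm (exp a) \<le> norm (exp b) + norm (exp a - exp b)"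
    by (rule norm_triangle_sub)
  moreover have "norm (exp a) * s \<le> (norm (exp b) + norm (exp a - exp b)) * s"
    using calculation s0 by (intro mult_right_mono) auto
  moreover have "0 \<le> s * norm (exp a - exp b)" using s0 by simp
  ultimately have "s * max (norm (exp a)) (norm (exp b)) \<le> (1 + s) * norm (exp a - exp b)"
    by (auto simp: max_def algebra_simps)
  then show ?thesis using s0 by (simp add: field_simps)
qed

section \<open>Perturbed first order equations on an interval\<close>

lemma exp_has_vector_derivative:
  "((\<lambda>s. exp (a + c * of_real s)) has_vector_derivative c * exp (a + c * of_real s)) (at s)" for a c :: complex
  by (rule has_vector_derivative_real_field[where f = "\<lambda>z. exp (a + c * z)"])
    (auto intro!: derivative_eq_intros)

text \<open>Mean value inequality on an unoriented segment, so that \<open>x < a\<close> is covered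
  when integrating backwards from a right endpoint.\<close>

lemma norm_le_of_has_vector_derivative:
  fixes g :: "real \<Rightarrow> complex"
  assumes "\<And>s. s \<in> closed_segment a x \<Longrightarrow> (g has_vector_derivative g' s) (at s)"
    and "\<And>s. s \<in> closed_segment a x \<Longrightarrow> norm (g' s) \<le> K"
  shows "norm (g x - g a) \<le> K * \<bar>x - a\<bar>"
proof -
  have "norm (g x - g a) \<le> K * norm (x - a)"
  proof (rule differentiable_bound[where S = "closed_segment a x" and f' = "\<lambda>s h. h *\<^sub>R g' s"])
    fix s assume s: "s \<in> closed_segment a x"
    show "(g has_derivative (\<lambda>h. h *\<^sub>R g' s)) (at s within closed_segment a x)"
      using assms(1)[OF s] has_derivative_at_withinI unfolding has_vector_derivative_def by blast
    show "onorm (\<lambda>h. h *\<^sub>R g' s) \<le> K"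
      using assms(2)[OF s] by (intro onorm_le) (simp add: mult.commute[of K] mult_left_mono)
  qed auto
  then show ?thesis by simp
qed

text \<open>Variation of constants with the integrating factor \<open>exp (\<mu> * (x - s))\<close>.
  By \<open>decay\<close>, the passage from \<open>a\<close> to \<open>x\<close> goes in the
  direction where this factor has modulus at most 1, so the forcing is never amplified.\<close>

lemma perturbed_exponential_bound:
  fixes f h :: "real \<Rightarrow> complex"
  assumes f: "\<And>s. s \<in> closed_segment a x \<Longrightarrow> (f has_vector_derivative \<mu> * f s + h s) (at s)"
    and h: "\<And>s. s \<in> closed_segment a x \<Longrightarrow> norm (h s) \<le> K"
    and decay: "Re \<mu> * (x - a) \<le> 0"
  shows "norm (f x - exp (\<mu> * (x - a)) * f a) \<le> K * \<bar>x - a\<bar>"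
proof -
  define g where "g s = exp (\<mu> * of_real (x - s)) * f s" for s
  have "norm (g x - g a) \<le> K * \<bar>x - a\<bar>"
  proof (rule norm_le_of_has_vector_derivative)
    fix s assume s: "s \<in> closed_segment a x"
    have "((\<lambda>s. exp (\<mu> * of_real (x - s))) has_vector_derivative - \<mu> * exp (\<mu> * of_real (x - s))) (at s)"
      using exp_has_vector_derivative[of "\<mu> * of_real x" "- \<mu>" s] by (simp add: algebra_simps)
    then show "(g has_vector_derivative exp (\<mu> * of_real (x - s)) * h s) (at s)"
      unfolding g_def using f[OF s]
      by (auto intro!: has_vector_derivative_eq_rhs[OF has_vector_derivative_mult] simp: algebra_simps)
    \<comment> \<open>Since \<open>s\<close> lies between \<open>a\<close> and \<open>x\<close>, the
      difference \<open>x - s\<close> is zero or has the sign of \<open>x - a\<close>.\<close>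
    have "Re \<mu> * (x - s) \<le> 0"
    proof (cases "a \<le> x")
      case True
      then have "s \<le> x" using s by (auto simp: closed_segment_eq_real_ivl)
      moreover have "x = a \<or> Re \<mu> \<le> 0" using decay True by (auto simp: mult_le_0_iff)
      ultimately show ?thesis using s True by (auto simp: mult_le_0_iff closed_segment_eq_real_ivl)
    next
      case False
      then have "x \<le> s" using s by (auto simp: closed_segment_eq_real_ivl)
      moreover have "Re \<mu> \<ge> 0" using decay False by (auto simp: mult_le_0_iff)
      ultimately show ?thesis by (auto simp: mult_le_0_iff)
    qed
    then have "norm (exp (\<mu> * of_real (x - s))) \<le> 1"
      by (simp del: of_real_diff)
    then show "norm (exp (\<mu> * of_real (x - s)) * h s) \<le> K"
      using mult_mono[of "norm (exp (\<mu> * of_real (x - s)))" 1 "norm (h s)" K] h[OF s]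
      by (simp add: norm_mult)
  qed
  then show ?thesis by (simp add: g_def)
qed

text \<open>The boundary condition sits at \<open>0\<close> for the modes that do not grow relative to mode \<open>k\<close>
  and at \<open>B\<close> for those that do, so that every relative mode is estimated in its stable direction.\<close>

lemma dichotomy_estimate:
  fixes A h :: "nat \<Rightarrow> real \<Rightarrow> complex"
  assumes "0 \<le> B" "0 \<le> \<epsilon>" and k: "k < n"
    and A: "\<And>j x. j < n \<Longrightarrow> (A j has_vector_derivative w j * A j x + h j x) (at x)"
    and h: "\<And>j x. j < n \<Longrightarrow> norm (h j x) \<le> \<epsilon> * (\<Sum>m<n. norm (A m x))"
    and left: "\<And>j. j < n \<Longrightarrow> Re (w j) \<le> Re (w k) \<Longrightarrow> A j 0 = (if j = k then c else 0)"
    and right: "\<And>j. j < n \<Longrightarrow> Re (w k) < Re (w j) \<Longrightarrow> A j B = 0"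
    and small: "2 * real n * B * \<epsilon> \<le> 1"
    and j: "j < n" and x: "x \<in> {0..B}"
  shows "norm (A j x - (if j = k then c * exp (w k * x) else 0)) \<le> 2 * B * \<epsilon> * norm c * norm (exp (w k * x))"
proof -
  \<comment> \<open>Dividing by the \<open>k\<close>-th exponential leaves exponents
    \<open>w j - w k\<close>, of which the \<open>k\<close>-th is zero.\<close>
  define f where "f j x = exp (- (w k * of_real x)) * A j x" for j x
  have exp_deriv: "((\<lambda>s. exp (- (w k * of_real s))) has_vector_derivative - w k * exp (- (w k * of_real s))) (at s)" for s
    using exp_has_vector_derivative[of 0 "- w k" s] by simp
  have fderiv: "(f j has_vector_derivative (w j - w k) * f j s + exp (- (w k * of_real s)) * h j s) (at s)"
    if "j < n" for j s
    unfolding f_def using A[OF that, of s] exp_deriv[of s]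
    by (auto intro!: has_vector_derivative_eq_rhs[OF has_vector_derivative_mult] simp: algebra_simps)
  have cont: "continuous_on {0..B} (\<lambda>x. \<Sum>j<n. norm (f j x))"
    using fderiv has_vector_derivative_continuous
    by (intro continuous_on_sum continuous_on_norm continuous_at_imp_continuous_on) blast
  \<comment> \<open>The maximum over the whole interval gives a bound in terms of itself, which
    suits boundary data at both ends.\<close>
  obtain x0 where x0: "x0 \<in> {0..B}" and max: "\<And>x. x \<in> {0..B} \<Longrightarrow> (\<Sum>j<n. norm (f j x)) \<le> (\<Sum>j<n. norm (f j x0))"
    using continuous_attains_sup[OF _ _ cont] \<open>0 \<le> B\<close> by auto
  define S where "S = (\<Sum>j<n. norm (f j x0))"
  have S0: "0 \<le> S" by (simp add: S_def sum_nonneg)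
  have hS: "norm (exp (- (w k * of_real s)) * h j s) \<le> \<epsilon> * S" if "j < n" "s \<in> {0..B}" for j s
  proof -
    have "norm (exp (- (w k * of_real s)) * h j s)
        \<le> norm (exp (- (w k * of_real s))) * (\<epsilon> * (\<Sum>m<n. norm (A m s)))"
      unfolding norm_mult by (intro mult_left_mono h that) auto
    also have "\<dots> = \<epsilon> * (\<Sum>m<n. norm (f m s))"
      by (simp add: f_def norm_mult sum_distrib_left algebra_simps)
    also have "\<dots> \<le> \<epsilon> * S"
      unfolding S_def using max[OF that(2)] \<open>0 \<le> \<epsilon>\<close> by (rule mult_left_mono)
    finally show ?thesis .
  qed
  \<comment> \<open>The propagated boundary value is exactly the subtracted term: for
    \<open>j = k\<close> the exponent is zero, and otherwise the datum is zero.\<close>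
  have est: "norm (f j x - (if j = k then c else 0)) \<le> \<epsilon> * S * B" if j: "j < n" and x: "x \<in> {0..B}" for j x
  proof (cases "Re (w j) \<le> Re (w k)")
    case True
    have "norm (f j x - exp ((w j - w k) * of_real (x - 0)) * f j 0) \<le> \<epsilon> * S * \<bar>x - 0\<bar>"
      using x True hS[OF j]
      by (intro perturbed_exponential_bound[OF fderiv[OF j]])
        (auto simp: closed_segment_eq_real_ivl mult_le_0_iff split: if_splits)
    also have "\<dots> \<le> \<epsilon> * S * B" using x S0 \<open>0 \<le> \<epsilon>\<close> by (intro mult_left_mono) auto
    finally show ?thesis using left[OF j True] by (auto simp: f_def)
  next
    case False
    have "norm (f j x - exp ((w j - w k) * of_real (x - B)) * f j B) \<le> \<epsilon> * S * \<bar>x - B\<bar>"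
      using x False hS[OF j]
      by (intro perturbed_exponential_bound[OF fderiv[OF j]])
        (auto simp: closed_segment_eq_real_ivl mult_le_0_iff split: if_splits)
    also have "\<dots> \<le> \<epsilon> * S * B" using x S0 \<open>0 \<le> \<epsilon>\<close> by (intro mult_left_mono) auto
    finally show ?thesis using right[OF j] False by (auto simp: f_def)
  qed
  have "norm (f j x0) \<le> (if j = k then norm c else 0) + \<epsilon> * S * B" if "j < n" for j
    using est[OF that x0] norm_triangle_sub[of "f j x0" c] by (auto split: if_splits)
  then have "S \<le> (\<Sum>j<n. (if j = k then norm c else 0) + \<epsilon> * S * B)"
    unfolding S_def by (intro sum_mono) (auto simp: S_def)
  also have "\<dots> = norm c + n * (\<epsilon> * S * B)"
    using k by (simp add: sum.distrib)
  \<comment> \<open>By \<open>small\<close> the last term is at most \<open>S\<close> and can be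
    absorbed on the left.\<close>
  finally have "2 * S \<le> 2 * norm c + (2 * real n * B * \<epsilon>) * S" by (simp add: algebra_simps)
  also have "\<dots> \<le> 2 * norm c + 1 * S" using small S0 by (intro add_left_mono mult_right_mono) auto
  finally have "S \<le> 2 * norm c" by simp
  then have "norm (f j x - (if j = k then c else 0)) \<le> \<epsilon> * (2 * norm c) * B"
    using est[OF j x] \<open>0 \<le> B\<close> \<open>0 \<le> \<epsilon>\<close>
    by (meson mult_left_mono mult_right_mono order_trans)
  then have "norm (exp (w k * x)) * norm (f j x - (if j = k then c else 0)) \<le> norm (exp (w k * x)) * (\<epsilon> * (2 * norm c) * B)"
    by (intro mult_left_mono) auto
  moreover have "exp (w k * x) * (f j x - (if j = k then c else 0)) = A j x - (if j = k then c * exp (w k * x) else 0)"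
    by (auto simp: f_def algebra_simps exp_minus)
  ultimately have "norm (A j x - (if j = k then c * exp (w k * x) else 0))
      \<le> norm (exp (w k * x)) * (\<epsilon> * (2 * norm c) * B)"
    by (metis norm_mult)
  then show ?thesis by (simp only: mult_ac)
qed

subsection \<open>Modes of the differential equation\<close>

definition unity_root :: "nat \<Rightarrow> complex" where
  "unity_root n = exp (2 * pi * \<i> / of_nat n)"

lemma unity_root_power: "unity_root n ^ k = cis (2 * pi * k / n)"
  unfolding unity_root_def exp_of_nat_mult[symmetric] cis_conv_exp by (simp add: mult_ac)

lemma norm_unity_root [simp]: "norm (unity_root n) = 1"
  using unity_root_power[of n 1] by simp

lemma unity_root_power_n: "0 < n \<Longrightarrow> unity_root n ^ n = 1"
  by (simp add: unity_root_power)

lemma unity_root_power_power_n: "0 < n \<Longrightarrow> (unity_root n ^ j) ^ n = 1"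
  by (metis mult.commute power_mult power_one unity_root_power_n)

lemma inj_on_unity_root_power: "inj_on (\<lambda>k. unity_root n ^ k) {..<n}"
  using Complex.bij_betw_roots_unity[of n] by (cases "n = 0") (auto simp: bij_betw_def unity_root_power)

lemma unity_root_power_eq_iff:
  "j < n \<Longrightarrow> k < n \<Longrightarrow> unity_root n ^ j = unity_root n ^ k \<longleftrightarrow> j = k"
  using inj_on_unity_root_power[of n] by (auto simp: inj_on_def)

text \<open>Orthogonality of characters: a geometric sum whose ratio \<open>q\<close> satisfies
  \<open>q ^ n = 1\<close> and equals 1 only for \<open>l = m\<close>.\<close>

lemma sum_unity_root:
  assumes "l < n" "m < n"
  shows "(\<Sum>j<n. (unity_root n ^ j) ^ l / (unity_root n ^ j) ^ m) = (if l = m then of_nat n else 0)"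
proof -
  define q where "q = unity_root n ^ l / unity_root n ^ m"
  have nz: "unity_root n \<noteq> 0" by (simp add: unity_root_def)
  have "(unity_root n ^ j) ^ l / (unity_root n ^ j) ^ m = q ^ j" for j
    by (simp add: q_def power_divide power_mult[symmetric] mult.commute)
  moreover have "q ^ n = 1"
    using assms by (simp add: q_def power_divide unity_root_power_power_n)
  moreover have "q = 1 \<longleftrightarrow> l = m"
    using assms nz by (simp add: q_def unity_root_power_eq_iff)
  ultimately show ?thesis by (simp add: sum_gp_strict)
qed

text \<open>The coefficients of a jet \<open>d\<close> of order \<open>n - 1\<close> in the basis of jets at \<open>0\<close> of \<open>x \<mapsto> exp (w j * x)\<close>,
  where \<open>w j = r * unity_root n ^ j\<close>; inverting the Vandermonde matrix is a discrete Fourier transform.\<close>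

definition mode :: "nat \<Rightarrow> complex \<Rightarrow> (nat \<Rightarrow> complex) \<Rightarrow> nat \<Rightarrow> complex" where
  "mode n r d j = (\<Sum>l<n. d l / (unity_root n ^ j * r) ^ l) / of_nat n"

text \<open>Fourier inversion by character orthogonality. For \<open>l = 0\<close> it says that a
  function is the sum of its modes.\<close>

lemma jet_eq_sum_mode:
  assumes "l < n" "r \<noteq> 0"
  shows "d l = (\<Sum>j<n. (unity_root n ^ j * r) ^ l * mode n r d j)"
proof -
  have nz: "unity_root n \<noteq> 0" by (simp add: unity_root_def)
  have "(\<Sum>j<n. (unity_root n ^ j * r) ^ l * mode n r d j)
      = (\<Sum>j<n. \<Sum>m<n. (d m * r ^ l / r ^ m / of_nat n) * ((unity_root n ^ j) ^ l / (unity_root n ^ j) ^ m))"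
    by (simp add: mode_def sum_distrib_left sum_divide_distrib power_mult_distrib field_simps)
  also have "\<dots> = (\<Sum>m<n. (d m * r ^ l / r ^ m / of_nat n) * (\<Sum>j<n. (unity_root n ^ j) ^ l / (unity_root n ^ j) ^ m))"
    by (subst sum.swap) (simp add: sum_distrib_left)
  also have "\<dots> = (\<Sum>m<n. if m = l then d l else 0)"
    using assms by (intro sum.cong refl) (auto simp: sum_unity_root)
  also have "\<dots> = d l" using assms by simp
  finally show ?thesis ..
qed

text \<open>Shifting the jet index by one amounts to multiplication by \<open>w\<close>, except at
  the two ends of the sum. The end terms form the forcing, which vanishes for the unperturbed
  equation.\<close>

lemma mode_has_vector_derivative:
  assumes n: "0 < n" and r: "r \<noteq> 0"
    and D: "\<And>l. l < n \<Longrightarrow> (D l has_vector_derivative D (Suc l) x) (at x)"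
  shows "((\<lambda>x. mode n r (\<lambda>l. D l x) j) has_vector_derivative
    unity_root n ^ j * r * mode n r (\<lambda>l. D l x) j
      + (D n x - r ^ n * D 0 x) / (of_nat n * (unity_root n ^ j * r) ^ (n - 1))) (at x)"
proof -
  define w where "w = unity_root n ^ j * r"
  have w: "w \<noteq> 0" using r by (simp add: w_def unity_root_def)
  have "w ^ n = r ^ n"
    using n by (simp add: w_def power_mult_distrib unity_root_power_power_n)
  then have wn: "w * w ^ (n - 1) = r ^ n" using n by (simp add: power_eq_if)
  have "((\<lambda>x. mode n r (\<lambda>l. D l x) j) has_vector_derivative (\<Sum>l<n. D (Suc l) x / w ^ l) / of_nat n) (at x)"
    unfolding mode_def w_def by (intro has_vector_derivative_divide has_vector_derivative_sum D) auto
  moreover have "(\<Sum>l<n. D (Suc l) x / w ^ l)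
      = w * (\<Sum>l<n. D l x / w ^ l) + (D n x - r ^ n * D 0 x) / w ^ (n - 1)"
  proof -
    obtain m where m: "n = Suc m" using n by (cases n) auto
    have "(\<Sum>l<n. D (Suc l) x / w ^ l) = (\<Sum>l<m. D (Suc l) x / w ^ l) + D n x / w ^ m"
      by (simp add: m)
    also have "(\<Sum>l<m. D (Suc l) x / w ^ l) = w * (\<Sum>l<m. D (Suc l) x / w ^ Suc l)"
      using w by (simp add: sum_distrib_left)
    also have "(\<Sum>l<m. D (Suc l) x / w ^ Suc l) = (\<Sum>l<n. D l x / w ^ l) - D 0 x"
      unfolding m by (subst sum.lessThan_Suc_shift) simp
    finally have "(\<Sum>l<n. D (Suc l) x / w ^ l) = w * ((\<Sum>l<n. D l x / w ^ l) - D 0 x) + D n x / w ^ m" .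
    moreover have nm: "n - 1 = m" by (simp add: m)
    \<comment> \<open>As \<open>w ^ n = r ^ n\<close>, the correction \<open>w * D 0 x\<close> left
      by the shift has the same denominator as the top term.\<close>
    moreover have "r ^ n / w ^ m = w" using w wn unfolding nm by (metis nonzero_mult_div_cancel_right power_not_zero)
    ultimately show ?thesis
      by (simp add: diff_divide_distrib right_diff_distrib flip: times_divide_eq_left)
  qed
  ultimately show ?thesis
    unfolding mode_def w_def[symmetric] by (simp add: add_divide_distrib mult_ac)
qed

text \<open>The equation has no term of order \<open>n - 1\<close>, so the perturbation is of size
  \<open>norm r ^ (n - 2)\<close> against the divisor \<open>norm r ^ (n - 1)\<close>. The gain of
  one power is the source of the final error rate; the factor \<open>n\<close> in the divisor
  absorbs the number of terms.\<close>

lemma norm_forcing_le: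
  fixes n :: nat and r :: complex
  assumes n: "2 \<le> n" and r: "1 \<le> norm r" and M: "\<And>l. l < n - 1 \<Longrightarrow> norm (q l) \<le> M"
    and eq: "d n + (\<Sum>l<n - 1. q l * d l) = r ^ n * d 0"
  shows "norm ((d n - r ^ n * d 0) / (of_nat n * (unity_root n ^ j * r) ^ (n - 1)))
    \<le> M / norm r * (\<Sum>m<n. norm (mode n r d m))"
proof -
  let ?S = "\<Sum>m<n. norm (mode n r d m)"
  have r0: "r \<noteq> 0" using r by auto
  have M0: "0 \<le> M" using order_trans[OF norm_ge_zero M[of 0]] n by simp
  have S0: "0 \<le> ?S" by (simp add: sum_nonneg)
  have dl: "norm (d l) \<le> norm r ^ l * ?S" if "l < n" for l
  proof -
    have "norm (d l) = norm (\<Sum>j<n. (unity_root n ^ j * r) ^ l * mode n r d j)"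
      using jet_eq_sum_mode[OF that r0, of d] by simp
    also have "\<dots> \<le> (\<Sum>j<n. norm ((unity_root n ^ j * r) ^ l * mode n r d j))"
      by (rule norm_sum)
    also have "\<dots> = norm r ^ l * ?S"
      by (simp add: norm_mult norm_power sum_distrib_left)
    finally show ?thesis .
  qed
  have "norm (q l * d l) \<le> M * norm r ^ (n - 2) * ?S" if l: "l < n - 1" for l
  proof -
    have "norm (q l * d l) \<le> M * (norm r ^ l * ?S)"
      unfolding norm_mult using M[OF l] dl[of l] l M0 by (intro mult_mono) auto
    also have "\<dots> \<le> M * (norm r ^ (n - 2) * ?S)"
      using l M0 S0 r by (intro mult_left_mono mult_right_mono power_increasing) auto
    finally show ?thesis by (simp add: mult_ac)
  qed
  then have "norm (\<Sum>l<n - 1. q l * d l) \<le> of_nat (card {..<n - 1}) * (M * norm r ^ (n - 2) * ?S)"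
    by (intro sum_norm_bound) auto
  also have "\<dots> \<le> n * (M * norm r ^ (n - 2) * ?S)"
    using M0 S0 by (intro mult_right_mono) auto
  finally have "norm (d n - r ^ n * d 0) \<le> n * (M * norm r ^ (n - 2) * ?S)"
    using eq by (metis add_diff_cancel_left' norm_minus_commute)
  moreover have "n - 1 = Suc (n - 2)" using n by simp
  ultimately show ?thesis
    using n r0 by (simp add: norm_divide norm_mult norm_power field_simps)
qed

lemma mode_sum:
  "mode n r (\<lambda>l. \<Sum>i<m. d i l * c i) j = (\<Sum>i<m. mode n r (d i) j * c i)"
  unfolding mode_def sum_divide_distrib sum_distrib_right
  by (subst sum.swap) simp

section \<open>Separation of the exponents outside \<open>E_set\<close>\<close>

lemma cis_diff: "cis x - cis y = 2 * \<i> * sin ((x - y) / 2) * cis ((x + y) / 2)"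
proof (rule complex_eqI)
  show "Re (cis x - cis y) = Re (2 * \<i> * sin ((x - y) / 2) * cis ((x + y) / 2))"
    using sin_minus[of "(x - y) / 2"] by (simp add: cos_diff_cos minus_divide_left)
  show "Im (cis x - cis y) = Im (2 * \<i> * sin ((x - y) / 2) * cis ((x + y) / 2))"
    by (simp add: sin_diff_sin)
qed

text \<open>The difference of two exponents is linear in \<open>r\<close> and equals
  \<open>2 * pi * m * \<i>\<close> exactly at the centre \<open>z\<close> of a disc of
  \<open>E_set\<close>. A distance of at least \<open>\<delta>\<close> from \<open>z\<close> is
  therefore scaled by \<open>b\<close> and the chord length.\<close>

lemma exponent_gap_outside_E_set:
  fixes m :: int
  assumes "0 < b" "j < k" "k < n" and r: "r \<notin> E_set n b \<delta>"
    and \<kappa>: "0 \<le> \<kappa>" "\<kappa> \<le> norm (unity_root n ^ k - unity_root n ^ j)"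
  shows "\<delta> * b * \<kappa> \<le> norm (unity_root n ^ k * r * b - unity_root n ^ j * r * b - 2 * pi * m * \<i>)"
proof -
  define s where "s = sin (pi * (real k - real j) / n)"
  define z where "z = of_real (pi * m / (b * s)) * exp (- of_real (pi * (real j + real k) / n) * \<i>)"
  let ?\<rho> = "unity_root n"
  have "pi * (real k - real j) < pi * n" using assms by (intro mult_strict_left_mono) auto
  then have "0 < pi * (real k - real j) / n" "pi * (real k - real j) / n < pi"
    using assms by (auto simp: pos_divide_less_eq)
  then have s: "s > 0" unfolding s_def by (rule sin_gt_zero)
  have "z = of_real (pi * m / (b * s)) * cis (- (pi * (real j + real k) / n))"
    by (simp add: z_def cis_conv_exp mult.commute)
  moreover have "?\<rho> ^ k - ?\<rho> ^ j = 2 * \<i> * s * cis (pi * (real j + real k) / n)"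
    unfolding unity_root_power cis_diff s_def
    by (simp add: diff_divide_distrib add_divide_distrib algebra_simps)
  ultimately have "(?\<rho> ^ k - ?\<rho> ^ j) * b * z
      = (2 * \<i> * s * b * of_real (pi * m / (b * s))) * (cis (pi * (real j + real k) / n) * cis (- (pi * (real j + real k) / n)))"
    by (simp only: mult_ac)
  also have "\<dots> = 2 * pi * m * \<i>"
    using s \<open>0 < b\<close> unfolding cis_mult by (simp add: field_simps)
  finally have eq: "(?\<rho> ^ k - ?\<rho> ^ j) * b * z = 2 * pi * m * \<i>" .
  have "r \<notin> ball z \<delta>"
  proof
    assume "r \<in> ball z \<delta>"
    \<comment> \<open>The indices of \<open>E_set\<close> start at 1 and the powers here at 0; the
      two \<open>Suc\<close> cancel the \<open>- 2\<close> in its angle.\<close>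
    then have "r \<in> E_set n b \<delta>"
      unfolding E_set_def using assms(2,3)
      by (intro UN_I[of m] UN_I[of "Suc j"] UN_I[of "Suc k"]) (auto simp: z_def s_def)
    with r show False ..
  qed
  then have "\<delta> \<le> norm (r - z)" by (simp add: dist_norm norm_minus_commute)
  then have "\<delta> * b * \<kappa> \<le> norm (r - z) * b * norm (?\<rho> ^ k - ?\<rho> ^ j)"
    using \<open>0 < b\<close> \<kappa> by (intro mult_mono) auto
  also have "\<dots> = norm ((?\<rho> ^ k - ?\<rho> ^ j) * b * r - (?\<rho> ^ k - ?\<rho> ^ j) * b * z)"
    using \<open>0 < b\<close> by (simp add: norm_mult flip: right_diff_distrib)
  also have "\<dots> = norm (?\<rho> ^ k * r * b - ?\<rho> ^ j * r * b - 2 * pi * m * \<i>)"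
    unfolding eq by (simp add: algebra_simps)
  finally show ?thesis .
qed

lemma unity_root_separation:
  "\<exists>\<kappa>>0. \<forall>j k. j < k \<and> k < n \<longrightarrow> \<kappa> \<le> norm (unity_root n ^ k - unity_root n ^ j)"
proof -
  let ?d = "\<lambda>(j, k). norm (unity_root n ^ k - unity_root n ^ j)"
  let ?P = "{(j, k). j < k \<and> k < n}"
  have fin: "finite ?P" by (rule finite_subset[of _ "{..<n} \<times> {..<n}"]) auto
  have "?d p > 0" if "p \<in> ?P" for p
    using that by (auto simp: unity_root_power_eq_iff)
  \<comment> \<open>Inserting 1 keeps the set non-empty when there are no pairs.\<close>
  then have "0 < Min (insert 1 (?d ` ?P))" using fin by (subst Min_gr_iff) auto
  moreover have "Min (insert 1 (?d ` ?P)) \<le> ?d (j, k)" if "j < k \<and> k < n" for j k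
    using fin that by (intro Min_le) auto
  ultimately show ?thesis by auto
qed

text \<open>The estimate with zero boundary data gives uniqueness for the boundary value problem, and
  hence solvability, since the solution space has dimension \<open>n\<close>.\<close>

lemma exists_exponential_solution:
  fixes D :: "nat \<Rightarrow> nat \<Rightarrow> real \<Rightarrow> complex"
  assumes n: "2 \<le> n" and r: "1 \<le> norm r" and B: "0 \<le> B"
    and q: "\<And>l x. l < n - 1 \<Longrightarrow> norm (q l x) \<le> M"
    and D: "\<And>i l x. i < n \<Longrightarrow> l < n \<Longrightarrow> (D i l has_vector_derivative D i (Suc l) x) (at x)"
    and ode: "\<And>i x. i < n \<Longrightarrow> D i n x + (\<Sum>l<n - 1. q l x * D i l x) = r ^ n * D i 0 x"
    and init: "\<And>i l. i < n \<Longrightarrow> l < n \<Longrightarrow> D i l 0 = (if l = i then 1 else 0)"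
    and small: "2 * real n * B * (M / norm r) \<le> 1" and k: "k < n"
  shows "\<exists>c. \<forall>j<n. \<forall>x\<in>{0..B}.
    norm (mode n r (\<lambda>l. \<Sum>i<n. D i l x * c i) j - (if j = k then exp (unity_root n ^ k * r * x) else 0))
      \<le> 2 * B * (M / norm r) * norm (exp (unity_root n ^ k * r * x))"
proof -
  let ?w = "\<lambda>j. unity_root n ^ j * r"
  define A where "A c j x = mode n r (\<lambda>l. \<Sum>i<n. D i l x * c i) j" for c j x
  \<comment> \<open>The endpoint at which mode \<open>j\<close> is prescribed, as required by the
    dichotomy.\<close>
  define pt where "pt j = (if Re (?w j) \<le> Re (?w k) then 0 else B)" for j
  have r0: "r \<noteq> 0" using r by auto
  have M0: "0 \<le> M" using order_trans[OF norm_ge_zero q[of 0]] n by simp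
  \<comment> \<open>The datum \<open>a\<close> is kept general: \<open>a = 0\<close> will give
    uniqueness, and \<open>a = 1\<close> the required solution.\<close>
  have est: "norm (A c j x - (if j = k then a * exp (?w k * x) else 0))
      \<le> 2 * B * (M / norm r) * norm a * norm (exp (?w k * x))"
    if bc: "\<And>j. j < n \<Longrightarrow> A c j (pt j) = (if j = k then a else 0)"
      and j: "j < n" and x: "x \<in> {0..B}" for c a j x
  proof -
    define Y where "Y l x = (\<Sum>i<n. D i l x * c i)" for l x
    define h where "h j x = (Y n x - r ^ n * Y 0 x) / (of_nat n * (unity_root n ^ j * r) ^ (n - 1))" for j x
    have "(Y l has_vector_derivative Y (Suc l) x) (at x)" if "l < n" for l x
      unfolding Y_def using that
      by (auto intro!: has_vector_derivative_sum has_vector_derivative_eq_rhs[OF has_vector_derivative_mult_left] D)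
    then have deriv: "(A c j has_vector_derivative ?w j * A c j x + h j x) (at x)" for j x
      using mode_has_vector_derivative[of n r Y x j] n r0
      by (simp add: A_def[abs_def] Y_def[symmetric] h_def)
    have "Y n x + (\<Sum>l<n - 1. q l x * Y l x) = r ^ n * Y 0 x" for x
    proof -
      have "(\<Sum>l<n - 1. q l x * Y l x) = (\<Sum>i<n. (\<Sum>l<n - 1. q l x * D i l x) * c i)"
        unfolding Y_def sum_distrib_left sum_distrib_right
        by (subst sum.swap) (simp add: mult_ac)
      then have "Y n x + (\<Sum>l<n - 1. q l x * Y l x)
          = (\<Sum>i<n. (D i n x + (\<Sum>l<n - 1. q l x * D i l x)) * c i)"
        by (simp add: Y_def sum.distrib distrib_right)
      also have "\<dots> = (\<Sum>i<n. r ^ n * D i 0 x * c i)"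
        by (intro sum.cong refl) (simp only: ode lessThan_iff)
      finally show ?thesis by (simp add: Y_def sum_distrib_left mult.assoc)
    qed
    then have force: "norm (h j x) \<le> M / norm r * (\<Sum>m<n. norm (A c m x))" for j x
      using norm_forcing_le[OF n r, of "\<lambda>l. q l x" M "\<lambda>l. Y l x" j] q
      by (simp add: h_def A_def Y_def)
    have left: "A c j 0 = (if j = k then a else 0)" if "j < n" "Re (?w j) \<le> Re (?w k)" for j
      using bc[OF that(1)] that(2) by (simp add: pt_def del: times_complex.sel)
    have right: "A c j B = 0" if "j < n" "Re (?w k) < Re (?w j)" for j
      using bc[OF that(1)] that(2) by (auto simp: pt_def not_le[symmetric] simp del: times_complex.sel)
    have "0 \<le> M / norm r" using M0 by simp
    then show ?thesis
      by (rule dichotomy_estimate[OF B _ k deriv force left right small j x])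
  qed
  have "\<exists>c. \<forall>j<n. (\<Sum>i<n. mode n r (\<lambda>l. D i l (pt j)) j * c i) = (if j = k then 1 else 0)"
  proof (rule linear_system_solvable)
    fix c :: "nat \<Rightarrow> complex" and i
    assume z: "\<And>j. j < n \<Longrightarrow> (\<Sum>i<n. mode n r (\<lambda>l. D i l (pt j)) j * c i) = 0" and i: "i < n"
    \<comment> \<open>With zero data all modes vanish at 0, hence so does the jet there, which by
      \<open>init\<close> is \<open>c\<close> itself.\<close>
    have "A c j 0 = 0" if "j < n" for j
      using est[of c 0 j 0] z that B by (simp add: A_def mode_sum)
    then have "(\<Sum>m<n. D m i 0 * c m) = 0"
      using jet_eq_sum_mode[OF i r0, of "\<lambda>l. \<Sum>m<n. D m l 0 * c m"] by (simp add: A_def)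
    then show "c i = 0" using i by (simp add: init if_distrib[of "\<lambda>x. x * _"] cong: if_cong)
  qed
  then obtain c where c: "\<And>j. j < n \<Longrightarrow> A c j (pt j) = (if j = k then 1 else 0)"
    by (auto simp: A_def mode_sum)
  show ?thesis
    using est[of c 1, OF c] unfolding A_def mult_1_left mult_1_right norm_one by blast
qed

subsection \<open>Asymptotics of the determinant\<close>

text \<open>Numerator and denominator are the Vandermonde products with nodes
  \<open>exp (w j * b)\<close> and \<open>w j\<close>, to be matched with \<open>V\<close> and
  \<open>W\<close> below.\<close>

lemma Htilde_eq:
  assumes "0 < n"
  shows "Htilde n b lam
    = (\<Prod>(j, k)\<in>{(j, k). j < k \<and> k < n}. exp (unity_root n ^ k * nroot n lam * b) - exp (unity_root n ^ j * nroot n lam * b))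
      / (\<Prod>(j, k)\<in>{(j, k). j < k \<and> k < n}. unity_root n ^ k * nroot n lam - unity_root n ^ j * nroot n lam)"
proof -
  have "{(j, k). j < k \<and> k \<le> n - 1} = {(j, k). j < k \<and> k < n}" using assms by auto
  then show ?thesis
    unfolding Htilde_def Let_def unity_root_def[symmetric] prod_dividef[symmetric]
    by (auto simp: left_diff_distrib intro!: prod.cong)
qed

text \<open>With \<open>c k\<close> the coefficients of the \<open>k\<close>-th exponential
  solution, the jets at 0 give \<open>det c = W * \<alpha>\<close> and the values at the points
  \<open>i * b\<close> give \<open>Hdet * det c = det Y\<close>. Here \<open>\<alpha>\<close> is
  close to 1 and \<open>det Y\<close> to \<open>V\<close>. The constant \<open>L\<close> is chosen
  so that \<open>L / norm r\<close> bounds both determinant errors, the second one relative to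
  \<open>S\<close>.\<close>

lemma Hdet_estimate:
  fixes n :: nat and b M K L \<gamma> :: real and r V W :: complex and w :: "nat \<Rightarrow> complex"
  defines "w \<equiv> \<lambda>j. unity_root n ^ j * r"
  defines "P \<equiv> {(j, k). j < k \<and> k < n}"
  defines "V \<equiv> \<Prod>(j, k)\<in>P. exp (w k * b) - exp (w j * b)" and "W \<equiv> \<Prod>(j, k)\<in>P. w k - w j"
  assumes n: "2 \<le> n" and b: "0 < b" and r: "1 \<le> norm r"
    and q: "\<And>l x. l < n - 1 \<Longrightarrow> norm (q l x) \<le> M"
    and u: "\<And>j. j < n \<Longrightarrow> fundamental_solution n q (r ^ n) j (u j)"
    and \<gamma>: "0 < \<gamma>"
    and gap: "\<And>j k. j < k \<Longrightarrow> k < n \<Longrightarrow>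
        \<gamma> * max (norm (exp (w k * b))) (norm (exp (w j * b))) \<le> norm (exp (w k * b) - exp (w j * b))"
    and K: "K = fact n * 2 ^ n" and L: "L = 2 * real n * (real n * b) * M * K" and Lr: "2 * L \<le> norm r"
  shows "norm (Hdet n b u - V / W) \<le> 2 * L * (1 + 1 / \<gamma> ^ card P) * norm (V / W) / norm r"
proof -
  \<comment> \<open>The interval \<open>[0, B]\<close> contains every evaluation point
    \<open>i * b\<close> with \<open>i < n\<close>.\<close>
  define B where "B = n * b"
  define \<epsilon> where "\<epsilon> = M / norm r"
  have B: "0 \<le> B" using b by (simp add: B_def)
  have r0: "r \<noteq> 0" "0 < norm r" using r by auto
  have M0: "0 \<le> M" using order_trans[OF norm_ge_zero q[of 0]] n by simp
  have \<epsilon>0: "0 \<le> \<epsilon>" using M0 by (simp add: \<epsilon>_def)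
  have K1: "1 \<le> K" using mult_mono[of 1 "fact n :: real" 1 "2 ^ n"] by (simp add: K)
  have L0: "0 \<le> L" using M0 K1 b by (simp add: L)
  have Leq: "K * (2 * real n * B * \<epsilon>) = L / norm r" by (simp add: L B_def \<epsilon>_def)
  have L2: "L / norm r \<le> 1 / 2" using Lr r0 by (simp add: field_simps)
  have nonneg: "0 \<le> 2 * B * \<epsilon>" "0 \<le> 2 * real n * B * \<epsilon>" using B \<epsilon>0 by auto
  have "2 * real n * B * \<epsilon> \<le> K * (2 * real n * B * \<epsilon>)"
    using mult_right_mono[OF K1 nonneg(2)] by simp
  then have small: "2 * real n * B * \<epsilon> \<le> 1" using Leq L2 by linarith
  have "1 * (2 * B * \<epsilon>) \<le> n * (2 * B * \<epsilon>)" using n nonneg(1) by (intro mult_right_mono) auto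
  then have n_mono: "2 * B * \<epsilon> \<le> 2 * real n * B * \<epsilon>" by (simp add: mult_ac)

  from u have "\<forall>j\<in>{..<n}. \<exists>D. D 0 = u j \<and>
      (\<forall>i<n. \<forall>x. (D i has_vector_derivative D (Suc i) x) (at x)) \<and>
      (\<forall>x. D n x + (\<Sum>k<n - 1. q k x * D k x) = r ^ n * u j x) \<and>
      (\<forall>i<n. D i 0 = (if i = j then 1 else 0))"
    by (simp add: fundamental_solution_def)
  then obtain D where D: "\<And>j. j < n \<Longrightarrow> D j 0 = u j"
      "\<And>i l x. i < n \<Longrightarrow> l < n \<Longrightarrow> (D i l has_vector_derivative D i (Suc l) x) (at x)"
      "\<And>j x. j < n \<Longrightarrow> D j n x + (\<Sum>k<n - 1. q k x * D j k x) = r ^ n * u j x"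
      "\<And>i l. i < n \<Longrightarrow> l < n \<Longrightarrow> D i l 0 = (if l = i then 1 else 0)"
    unfolding bchoice_iff by auto blast
  have "\<forall>k\<in>{..<n}. \<exists>c. \<forall>j<n. \<forall>x\<in>{0..B}.
    norm (mode n r (\<lambda>l. \<Sum>i<n. D i l x * c i) j - (if j = k then exp (unity_root n ^ k * r * x) else 0))
      \<le> 2 * B * (M / norm r) * norm (exp (unity_root n ^ k * r * x))"
    using D small by (intro ballI exists_exponential_solution[OF n r B q]) (auto simp: \<epsilon>_def)
  from bchoice[OF this] obtain c where c: "\<forall>k\<in>{..<n}. \<forall>j<n. \<forall>x\<in>{0..B}.
    norm (mode n r (\<lambda>l. \<Sum>i<n. D i l x * c k i) j - (if j = k then exp (unity_root n ^ k * r * x) else 0))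
      \<le> 2 * B * (M / norm r) * norm (exp (unity_root n ^ k * r * x))"
    by (elim exE)
  define A where "A k j x = mode n r (\<lambda>l. \<Sum>i<n. D i l x * c k i) j" for k j x
  have A: "norm (A k j x - (if j = k then exp (w k * x) else 0)) \<le> 2 * B * \<epsilon> * norm (exp (w k * x))"
    if "k < n" "j < n" "x \<in> {0..B}" for k j x
    using c that unfolding A_def w_def \<epsilon>_def by simp
  have jet: "(\<Sum>i<n. D i l x * c k i) = (\<Sum>j<n. w j ^ l * A k j x)" if "l < n" for k l x
    using jet_eq_sum_mode[OF that r0(1), of "\<lambda>l. \<Sum>i<n. D i l x * c k i"] by (simp add: A_def w_def)

  define \<alpha> where "\<alpha> = detn n (\<lambda>j k. A k j 0)"
  define Y where "Y i k = (\<Sum>m<n. u m (of_nat i * b) * c k m)" for i k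
  \<comment> \<open>By the initial conditions, the jet at 0 of the \<open>k\<close>-th solution is
    its coefficient vector.\<close>
  have "detn n (\<lambda>m k. c k m) = detn n (\<lambda>l k. \<Sum>j<n. w j ^ l * A k j 0)"
  proof (rule detn_cong)
    fix l k assume "l < n" "k < n"
    then show "c k l = (\<Sum>j<n. w j ^ l * A k j 0)"
      by (simp add: jet[symmetric] D(4) if_distrib[of "\<lambda>x. x * _"] cong: if_cong)
  qed
  also have "\<dots> = W * \<alpha>"
    unfolding detn_mult \<alpha>_def by (simp add: detn_vandermonde W_def P_def)
  finally have detY: "detn n Y = Hdet n b u * (W * \<alpha>)"
    unfolding Y_def Hdet_def detn_mult by simp

  \<comment> \<open>At 0 all exponentials are 1, so the matrix of modes is entrywise close to the
    identity.\<close>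
  have "norm (\<alpha> - detn n (\<lambda>j k. if j = k then 1 else 0)) \<le> fact n * 2 ^ n * (2 * B * \<epsilon>) * 1"
    unfolding \<alpha>_def
  proof (rule norm_detn_diff_le[where s = "\<lambda>_ _. 1"])
    show "2 * B * \<epsilon> \<le> 1" using small n_mono by linarith
    show "norm (A k j 0 - (if j = k then 1 else 0)) \<le> 2 * B * \<epsilon> * 1" if "j < n" "k < n" for j k
      using A[of k j 0] that B by (auto split: if_splits)
  qed (use nonneg in auto)
  moreover have "detn n (\<lambda>j k. if j = k then 1 else 0) = (1 :: complex)"
    by (subst detn_lower_triangular) auto
  moreover have "K * (2 * B * \<epsilon>) \<le> L / norm r"
    unfolding Leq[symmetric] using K1 n_mono by (intro mult_left_mono) auto
  ultimately have \<alpha>: "norm (\<alpha> - 1) \<le> L / norm r" by (simp add: K)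
  have \<alpha>2: "1 / 2 \<le> norm \<alpha>"
  proof -
    have "1 - norm (\<alpha> - 1) \<le> norm \<alpha>"
      using norm_triangle_ineq2[of 1 "1 - \<alpha>"] by (simp add: norm_minus_commute)
    then show ?thesis using \<alpha> L2 by linarith
  qed

  define S where "S = (\<Prod>(j, k)\<in>P. max (norm (exp (w j * b))) (norm (exp (w k * b))))"
  have "norm (detn n Y - detn n (\<lambda>i k. exp (w k * b) ^ i)) \<le> fact n * 2 ^ n * (2 * real n * B * \<epsilon>) * S"
  proof (rule norm_detn_diff_le[where s = "\<lambda>i k. norm (exp (w k * b)) ^ i"])
    show "norm (Y i k - exp (w k * b) ^ i) \<le> 2 * real n * B * \<epsilon> * norm (exp (w k * b)) ^ i" if "i < n" "k < n" for i k
    proof -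
      have ib: "of_nat i * b \<in> {0..B}" using that b by (simp add: B_def)
      have pow: "exp (w k * b) ^ i = exp (w k * of_real (of_nat i * b))"
        by (simp add: mult_ac flip: exp_of_nat_mult)
      \<comment> \<open>The jet formula with \<open>l = 0\<close>; adding the errors of all modes
        costs a factor \<open>n\<close>.\<close>
      have "Y i k = (\<Sum>m<n. A k m (of_nat i * b))"
        using jet[of 0 "of_nat i * b" k] n by (simp add: Y_def D(1))
      moreover have "exp (w k * b) ^ i = (\<Sum>m<n. if m = k then exp (w k * of_real (of_nat i * b)) else 0)"
        using that(2) by (subst sum.delta) (auto simp: pow)
      ultimately have "Y i k - exp (w k * b) ^ i
          = (\<Sum>m<n. A k m (of_nat i * b) - (if m = k then exp (w k * of_real (of_nat i * b)) else 0))"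
        by (simp only: sum_subtractf)
      also have "norm \<dots> \<le> of_nat (card {..<n}) * (2 * B * \<epsilon> * norm (exp (w k * of_real (of_nat i * b))))"
        using A[OF that(2) _ ib] by (intro sum_norm_bound) auto
      finally show ?thesis
        unfolding pow[symmetric] by (simp add: norm_power mult_ac)
    qed
    show "(\<Prod>i<n. norm (exp (w (\<sigma> i) * b)) ^ i) \<le> S" if "\<sigma> permutes {..<n}" for \<sigma>
      using prod_permuted_powers_le[OF that, of "\<lambda>k. norm (exp (w k * b))"] by (simp add: S_def P_def)
  qed (use nonneg small in \<open>auto simp: norm_power\<close>)
  then have Y: "norm (detn n Y - V) \<le> L / norm r * S"
    unfolding Leq[symmetric] by (simp add: detn_vandermonde V_def P_def K)
  \<comment> \<open>The gap, used once per pair, excludes cancellation in \<open>V\<close> and makes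
    \<open>S\<close> comparable to it.\<close>
  have "\<gamma> ^ card P * S = (\<Prod>(j, k)\<in>P. \<gamma> * max (norm (exp (w j * b))) (norm (exp (w k * b))))"
    by (simp add: S_def prod.distrib case_prod_unfold)
  also have "\<dots> \<le> norm V"
    unfolding V_def prod_norm[symmetric] using gap \<gamma>
    by (intro prod_mono) (auto simp: P_def max.commute le_max_iff_disj)
  finally have S: "S \<le> 1 / \<gamma> ^ card P * norm V" using \<gamma> by (simp add: field_simps)

  have W0: "W \<noteq> 0"
    using r0(1) unfolding W_def P_def
    by (subst prod_zero_iff)
      (auto simp: w_def unity_root_power_eq_iff intro: finite_subset[of _ "{..<n} \<times> {..<n}"])
  have \<alpha>0: "\<alpha> \<noteq> 0" using \<alpha>2 by auto
  \<comment> \<open>The error splits into that of \<open>det Y\<close> and that of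
    \<open>\<alpha>\<close>; dividing by \<open>\<alpha>\<close> costs a factor 2.\<close>
  have "Hdet n b u - V / W = ((detn n Y - V) - V * (\<alpha> - 1)) / (W * \<alpha>)"
    unfolding detY using W0 \<alpha>0 by (simp add: field_simps)
  also have "norm \<dots> = norm ((detn n Y - V) - V * (\<alpha> - 1)) / (norm W * norm \<alpha>)"
    by (simp add: norm_divide norm_mult)
  also have "\<dots> \<le> (L / norm r * (1 / \<gamma> ^ card P * norm V) + norm V * (L / norm r)) / (norm W * (1 / 2))"
  proof (rule frac_le)
    show "norm ((detn n Y - V) - V * (\<alpha> - 1)) \<le> L / norm r * (1 / \<gamma> ^ card P * norm V) + norm V * (L / norm r)"
      unfolding norm_mult[symmetric]
    proof (rule norm_triangle_le_diff, rule add_mono)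
      show "norm (detn n Y - V) \<le> L / norm r * (1 / \<gamma> ^ card P * norm V)"
        using L0 by (intro order_trans[OF Y] mult_left_mono S) auto
      show "norm (V * (\<alpha> - 1)) \<le> norm V * (L / norm r)"
        unfolding norm_mult by (intro mult_left_mono \<alpha>) auto
    qed
  qed (use W0 \<alpha>2 L0 \<gamma> in \<open>auto intro!: add_nonneg_nonneg mult_left_mono\<close>)
  also have "\<dots> = 2 * L * (1 + 1 / \<gamma> ^ card P) * norm (V / W) / norm r"
    using W0 r0 \<gamma> by (simp add: norm_divide field_simps)
  finally show ?thesis .
qed

section \<open>Return from the root \<open>r\<close> to the spectral parameter\<close>

lemma nroot_power: "0 < n \<Longrightarrow> nroot n z ^ n = z"
  unfolding nroot_def by (cases "z = 0") (auto simp: powr_def simp flip: exp_of_nat_mult)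

lemma norm_nroot: "norm (nroot n z) = norm z powr (1 / n)"
  unfolding nroot_def using norm_powr_real_powr'[of "1 / of_nat n" z] by simp

text \<open>The relative error is multiplied through by \<open>Htilde\<close>, and \<open>C\<close>
  and \<open>R\<close> precede \<open>t\<close>, which expresses the uniformity.\<close>

theorem theorem4:
  fixes n :: nat and b M :: real and T :: "real set"
    and p :: "nat \<Rightarrow> real \<Rightarrow> real \<Rightarrow> complex"
    and u :: "real \<Rightarrow> complex \<Rightarrow> nat \<Rightarrow> real \<Rightarrow> complex"
  assumes n2: "n \<ge> 2" and bpos: "b > 0" and T_int: "is_interval T"
    and p_smooth_x: "\<And>k t. k \<le> n - 2 \<Longrightarrow> t \<in> T \<Longrightarrow> smooth_rc (\<lambda>x. p k x t)"
    and p_periodic: "\<And>k x t. k \<le> n - 2 \<Longrightarrow> t \<in> T \<Longrightarrow> p k (x + b) t = p k x t"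
    and p_smooth_t: "\<And>k x. k \<le> n - 2 \<Longrightarrow> smooth_rc_on T (\<lambda>t. p k x t)"
    and p_bound: "\<And>k x t. k \<le> n - 2 \<Longrightarrow> t \<in> T \<Longrightarrow> norm (p k x t) \<le> M"
    and u_fund: "\<And>t lam j. t \<in> T \<Longrightarrow> j < n \<Longrightarrow>
                   fundamental_solution n (\<lambda>k x. p k x t) lam j (u t lam j)"
    and \<delta>pos: "\<delta> > 0"
  shows "\<exists>C R. \<forall>t\<in>T. \<forall>lam. norm lam \<ge> R \<and> nroot n lam \<notin> E_set n b \<delta> \<longrightarrow>
           norm (Hdet n b (u t lam) - Htilde n b lam)
             \<le> C * norm (Htilde n b lam) * norm lam powr (- 1 / real n)"
proof -
  obtain \<kappa> where \<kappa>: "0 < \<kappa>" "\<And>j k. j < k \<Longrightarrow> k < n \<Longrightarrow> \<kappa> \<le> norm (unity_root n ^ k - unity_root n ^ j)"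
    using unity_root_separation[of n] by blast
  \<comment> \<open>Outside \<open>E_set\<close> the exponents stay
    \<open>\<delta> * b * \<kappa>\<close> apart modulo \<open>2 * pi * \<i>\<close>;
    \<open>s\<close> and \<open>\<gamma>\<close> are the resulting constants of
    \<open>norm_exp_diff_ge\<close>.\<close>
  define s where "s = min (1 / 2) (\<delta> * b * \<kappa> / 2)"
  define \<gamma> where "\<gamma> = s / (1 + s)"
  have s: "0 < s" using \<kappa> bpos \<delta>pos by (simp add: s_def)
  define K :: real where "K = fact n * 2 ^ n"
  define L where "L = 2 * real n * (real n * b) * M * K"
  define C where "C = 2 * L * (1 + 1 / \<gamma> ^ card {(j, k). j < k \<and> k < n})"
  \<comment> \<open>Taking \<open>n\<close>-th roots, \<open>norm lam \<ge> R\<close> becomes both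
    size conditions on \<open>r\<close> at once.\<close>
  define R where "R = max 1 (2 * L) ^ n"
  show ?thesis
  proof (rule exI[of _ C], rule exI[of _ R], intro ballI allI impI, elim conjE)
    fix t lam assume t: "t \<in> T" and lam: "R \<le> norm lam" and E: "nroot n lam \<notin> E_set n b \<delta>"
    define r where "r = nroot n lam"
    have rn: "r ^ n = lam" using n2 by (simp add: r_def nroot_power)
    have "max 1 (2 * L) ^ n \<le> norm r ^ n" using lam by (simp add: R_def flip: rn norm_power)
    then have "max 1 (2 * L) \<le> norm r" using n2 by (subst (asm) power_mono_iff) auto
    then have r1: "1 \<le> norm r" and Lr: "2 * L \<le> norm r" by auto
    have gap: "\<gamma> * max (norm (exp (unity_root n ^ k * r * b))) (norm (exp (unity_root n ^ j * r * b)))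
        \<le> norm (exp (unity_root n ^ k * r * b) - exp (unity_root n ^ j * r * b))"
      if "j < k" "k < n" for j k
      unfolding \<gamma>_def using \<kappa> bpos \<delta>pos that E
      by (intro norm_exp_diff_ge[OF _ _ s_def] exponent_gap_outside_E_set) (auto simp: r_def)
    have q: "norm (p l x t) \<le> M" if "l < n - 1" for l x
      using that by (intro p_bound t) auto
    have \<gamma>: "0 < \<gamma>" using s by (simp add: \<gamma>_def)
    have "norm (Hdet n b (u t lam) - Htilde n b lam) \<le> C * norm (Htilde n b lam) / norm r"
      using Hdet_estimate[OF n2 bpos r1 q u_fund[OF t] \<gamma> gap K_def L_def Lr] n2
      by (simp add: Htilde_eq C_def rn flip: r_def)
    also have "\<dots> = C * norm (Htilde n b lam) * norm lam powr (- 1 / real n)"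
      by (simp add: r_def norm_nroot powr_minus_divide)
    finally show "norm (Hdet n b (u t lam) - Htilde n b lam)
        \<le> C * norm (Htilde n b lam) * norm lam powr (- 1 / real n)" .
  qed
qed

end
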